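(* Let $k_0,j_0\in\mathbb{N}$ with $1\le k_0\le j_0$. Every bounded weighted shift operator $S_{\boldsymbol{\lambda}}$ on the directed tree $\mathcal{T}^2_{k_0,j_0}$ is cyclic.
   Context: $\mathcal{T}^2_{k_0,j_0}=(V,E)$ is the directed tree with vertex set $V=\{k\in\mathbb{Z}\colon k\le j_0\}\cup\{1',2',\dots,k_0'\}$ (the primed symbols are distinct additional vertices) and edge set $E=\{(k,k+1)\colon k\in\mathbb{Z},\,k<j_0\}\cup\{(0,1')\}\cup\{(k',(k+1)')\colon k\in\mathbb{N},\,k<k_0\}$. For $u\in V$, $\mathrm{Chi}(u)=\{v\in V\colon(u,v)\in E\}$. Given a bounded family of positive weights $\boldsymbol{\lambda}=\{\lambda_v\colon v\in V\}\subseteq(0,\infty)$, the weighted shift $S_{\boldsymbol{\lambda}}$ is the bounded operator on the complex Hilbert space $\ell^2(V)$ (with orthonormal basis $\{e_u\}_{u\in V}$) given by $S_{\boldsymbol{\lambda}}e_u=\sum_{v\in\mathrm{Chi}(u)}\lambda_ve_v$ (all weights are assumed positive). An operator $T\in\mathcal{B}(\mathcal{H})$ is cyclic if there is $h\in\mathcal{H}$ such that the closed linear span of $\{T^nh\colon n\ge0\}$ is $\mathcal{H}$. *)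

theory Defs
  imports "HOL-Analysis.Analysis"
begin

section \<open>The complex Hilbert space of square-summable families\<close>

typedef 'a ell2 = "{f :: 'a \<Rightarrow> complex. (\<lambda>x. (cmod (f x))\<^sup>2) summable_on UNIV}"
  morphisms ell2_coord Abs_ell2
  by (rule exI[of _ "\<lambda>_. 0"]) simp

setup_lifting type_definition_ell2

lemma ell2_summable: "(\<lambda>x. (cmod (ell2_coord f x))\<^sup>2) summable_on UNIV"
  using ell2_coord[of f] by simp

lemma ell2_summable_add:
  fixes f g :: "'a \<Rightarrow> complex"
  assumes "(\<lambda>x. (cmod (f x))\<^sup>2) summable_on UNIV" "(\<lambda>x. (cmod (g x))\<^sup>2) summable_on UNIV"
  shows "(\<lambda>x. (cmod (f x + g x))\<^sup>2) summable_on UNIV"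
proof (rule summable_on_comparison_test)
  show "(\<lambda>x. 2 * (cmod (f x))\<^sup>2 + 2 * (cmod (g x))\<^sup>2) summable_on UNIV"
    using assms by (intro summable_on_add summable_on_cmult_right)
  fix x
  have "(cmod (f x + g x))\<^sup>2 \<le> (cmod (f x) + cmod (g x))\<^sup>2"
    by (intro power_mono norm_triangle_ineq) auto
  also have "\<dots> \<le> 2 * (cmod (f x))\<^sup>2 + 2 * (cmod (g x))\<^sup>2"
    using zero_le_power2[of "cmod (f x) - cmod (g x)"]
    by (simp add: power2_eq_square algebra_simps)
  finally show "(cmod (f x + g x))\<^sup>2 \<le> 2 * (cmod (f x))\<^sup>2 + 2 * (cmod (g x))\<^sup>2" .
qed auto

lemma ell2_summable_scale:
  fixes f :: "'a \<Rightarrow> complex"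
  assumes "(\<lambda>x. (cmod (f x))\<^sup>2) summable_on UNIV"
  shows "(\<lambda>x. (cmod (c * f x))\<^sup>2) summable_on UNIV"
  unfolding norm_mult power_mult_distrib by (intro summable_on_cmult_right assms)

lemma ell2_summable_inner:
  fixes f g :: "'a \<Rightarrow> complex"
  assumes "(\<lambda>x. (cmod (f x))\<^sup>2) summable_on UNIV" "(\<lambda>x. (cmod (g x))\<^sup>2) summable_on UNIV"
  shows "(\<lambda>x. f x \<bullet> g x) summable_on UNIV"
proof (rule abs_summable_summable, rule summable_on_comparison_test)
  show "(\<lambda>x. (cmod (f x))\<^sup>2 + (cmod (g x))\<^sup>2) summable_on UNIV"
    using assms by (intro summable_on_add)
  fix x
  have "norm (f x \<bullet> g x) \<le> cmod (f x) * cmod (g x)"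
    using Cauchy_Schwarz_ineq2[of "f x" "g x"] by simp
  also have "\<dots> \<le> (cmod (f x))\<^sup>2 + (cmod (g x))\<^sup>2"
  proof -
    have "2 * (cmod (f x) * cmod (g x)) \<le> (cmod (f x))\<^sup>2 + (cmod (g x))\<^sup>2"
      using sum_squares_bound[of "cmod (f x)" "cmod (g x)"] by (simp add: mult.assoc)
    moreover have "0 \<le> cmod (f x) * cmod (g x)" by simp
    ultimately show ?thesis by linarith
  qed
  finally show "norm (f x \<bullet> g x) \<le> (cmod (f x))\<^sup>2 + (cmod (g x))\<^sup>2" .
qed auto

lift_definition scaleC :: "complex \<Rightarrow> 'a ell2 \<Rightarrow> 'a ell2" (infixr \<open>*\<^sub>C\<close> 75)
  is "\<lambda>c f x. c * f x"
  by (rule ell2_summable_scale)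

text \<open>
  As a real inner product space, with \<open>f \<bullet> g\<close> the real part of \<open>\<Sum>x. f x * cnj (g x)\<close>;
  the norm is the usual one, and it is the norm belonging to the complex inner product.
\<close>

instantiation ell2 :: (type) real_inner
begin

lift_definition zero_ell2 :: "'a ell2" is "\<lambda>_. 0"
  by simp

lift_definition plus_ell2 :: "'a ell2 \<Rightarrow> 'a ell2 \<Rightarrow> 'a ell2" is "\<lambda>f g x. f x + g x"
  by (rule ell2_summable_add)

lift_definition uminus_ell2 :: "'a ell2 \<Rightarrow> 'a ell2" is "\<lambda>f x. - f x"
  by simp

definition minus_ell2 :: "'a ell2 \<Rightarrow> 'a ell2 \<Rightarrow> 'a ell2" where
  "f - g = f + - g" for f g :: "'a ell2"

definition scaleR_ell2 :: "real \<Rightarrow> 'a ell2 \<Rightarrow> 'a ell2" where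
  "r *\<^sub>R f = of_real r *\<^sub>C f" for f :: "'a ell2"

lift_definition inner_ell2 :: "'a ell2 \<Rightarrow> 'a ell2 \<Rightarrow> real"
  is "\<lambda>f g. \<Sum>\<^sub>\<infinity>x. f x \<bullet> g x" .

definition norm_ell2 :: "'a ell2 \<Rightarrow> real" where
  "norm f = sqrt (f \<bullet> f)" for f :: "'a ell2"

definition sgn_ell2 :: "'a ell2 \<Rightarrow> 'a ell2" where
  "sgn f = inverse (norm f) *\<^sub>R f" for f :: "'a ell2"

definition dist_ell2 :: "'a ell2 \<Rightarrow> 'a ell2 \<Rightarrow> real" where
  "dist f g = norm (f - g)" for f g :: "'a ell2"

definition uniformity_ell2 :: "('a ell2 \<times> 'a ell2) filter" where
  "uniformity_ell2 = (INF e\<in>{0<..}. principal {(f, g). dist f g < e})"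

definition open_ell2 :: "'a ell2 set \<Rightarrow> bool" where
  "open_ell2 U \<longleftrightarrow> (\<forall>f\<in>U. eventually (\<lambda>(f', g). f' = f \<longrightarrow> g \<in> U) uniformity)"

instance
proof
  fix f g h :: "'a ell2" and r s :: real
  show "f + g + h = f + (g + h)" by transfer (simp add: add.assoc)
  show "f + g = g + f" by transfer (simp add: add.commute)
  show "0 + f = f" by transfer simp
  show "- f + f = 0" by transfer simp
  show "f - g = f + - g" by (fact minus_ell2_def)
  show "r *\<^sub>R (f + g) = r *\<^sub>R f + r *\<^sub>R g"
    unfolding scaleR_ell2_def by transfer (simp add: algebra_simps)
  show "(r + s) *\<^sub>R f = r *\<^sub>R f + s *\<^sub>R f"
    unfolding scaleR_ell2_def by transfer (simp add: algebra_simps)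
  show "r *\<^sub>R s *\<^sub>R f = (r * s) *\<^sub>R f"
    unfolding scaleR_ell2_def by transfer (simp add: algebra_simps)
  show "1 *\<^sub>R f = f" unfolding scaleR_ell2_def by transfer simp
  show "dist f g = norm (f - g)" by (fact dist_ell2_def)
  show "sgn f = inverse (norm f) *\<^sub>R f" by (fact sgn_ell2_def)
  show "(uniformity :: ('a ell2 \<times> 'a ell2) filter) = (INF e\<in>{0<..}. principal {(f, g). dist f g < e})"
    by (fact uniformity_ell2_def)
  show "open U \<longleftrightarrow> (\<forall>f\<in>U. eventually (\<lambda>(f', g). f' = f \<longrightarrow> g \<in> U) uniformity)"
    for U :: "'a ell2 set" by (fact open_ell2_def)
  show "f \<bullet> g = g \<bullet> f" by transfer (simp add: inner_commute)
  show "(f + g) \<bullet> h = f \<bullet> h + g \<bullet> h"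
    by transfer (auto simp: inner_add_left intro!: infsum_add ell2_summable_inner)
  show "r *\<^sub>R f \<bullet> g = r * (f \<bullet> g)"
    unfolding scaleR_ell2_def
    by transfer (simp add: scaleR_conv_of_real[symmetric] infsum_cmult_right' del: inner_complex_def)
  show nonneg: "0 \<le> f \<bullet> f" by transfer (intro infsum_nonneg inner_ge_zero)
  show "f \<bullet> f = 0 \<longleftrightarrow> f = 0"
  proof
    assume "f \<bullet> f = 0"
    then have *: "(\<Sum>\<^sub>\<infinity>x. (cmod (ell2_coord f x))\<^sup>2) = 0"
      by (simp add: inner_ell2.rep_eq power2_norm_eq_inner)
    have "(cmod (ell2_coord f x))\<^sup>2 = 0" for x
      by (rule nonneg_infsum_le_0D[OF _ ell2_summable]) (use * in auto)
    then show "f = 0" by (intro ell2_coord_inject[THEN iffD1] ext) (simp add: zero_ell2.rep_eq)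
  next
    assume "f = 0" then show "f \<bullet> f = 0" by (simp add: inner_ell2.rep_eq zero_ell2.rep_eq)
  qed
  show "norm f = sqrt (f \<bullet> f)" by (fact norm_ell2_def)
qed

end

lemma norm_ell2_eq: "norm f = sqrt (\<Sum>\<^sub>\<infinity>x. (cmod (ell2_coord f x))\<^sup>2)"
  by (simp add: norm_ell2_def inner_ell2.rep_eq power2_norm_eq_inner)

global_interpretation complex_ell2: vector_space "scaleC :: complex \<Rightarrow> 'a ell2 \<Rightarrow> 'a ell2"
  defines complex_span = complex_ell2.span
  by unfold_locales (transfer; simp add: algebra_simps)+

lift_definition basis_vec :: "'a \<Rightarrow> 'a ell2" is "\<lambda>u x. if x = u then 1 else 0"
proof -
  fix u :: 'a
  have "(\<lambda>x. (cmod (if x = u then 1 else 0))\<^sup>2) summable_on {u}" by simp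
  then show "(\<lambda>x. (cmod (if x = u then 1 else 0))\<^sup>2) summable_on UNIV"
    by (rule summable_on_cong_neutral[THEN iffD1, rotated -1]) auto
qed

text \<open>
  \<open>\<ell>\<^sup>2(V)\<close> for a set \<open>V\<close> is realised as the closed subspace of those elements of
  \<open>\<ell>\<^sup>2\<close> over the whole index type that vanish off \<open>V\<close>.
\<close>

definition ell2_space :: "'a set \<Rightarrow> 'a ell2 set" where
  "ell2_space V = {f. \<forall>x. x \<notin> V \<longrightarrow> ell2_coord f x = 0}"

section \<open>Bounded operators and cyclicity\<close>

text \<open>Operators on a subspace \<open>H\<close> are total functions whose values off \<open>H\<close> are irrelevant.\<close>

definition bounded_operator_on :: "'a ell2 set \<Rightarrow> ('a ell2 \<Rightarrow> 'a ell2) \<Rightarrow> bool" where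
  "bounded_operator_on H T \<longleftrightarrow>
     (\<forall>f\<in>H. T f \<in> H) \<and>
     (\<forall>f\<in>H. \<forall>g\<in>H. T (f + g) = T f + T g) \<and>
     (\<forall>c. \<forall>f\<in>H. T (c *\<^sub>C f) = c *\<^sub>C T f) \<and>
     (\<exists>K. \<forall>f\<in>H. norm (T f) \<le> K * norm f)"

definition cyclic_on :: "'a ell2 set \<Rightarrow> ('a ell2 \<Rightarrow> 'a ell2) \<Rightarrow> bool" where
  "cyclic_on H T \<longleftrightarrow> (\<exists>h\<in>H. closure (complex_span {(T ^^ n) h | n. True}) = H)"

section \<open>Weighted shifts on directed trees\<close>

definition Chi :: "'a set \<Rightarrow> ('a \<times> 'a) set \<Rightarrow> 'a \<Rightarrow> 'a set" where
  "Chi V E u = {v \<in> V. (u, v) \<in> E}"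

text \<open>
  The sum is meaningful only if each vertex has finitely many children, as is the case
  for the tree below.
\<close>

definition weighted_shift ::
    "'a set \<Rightarrow> ('a \<times> 'a) set \<Rightarrow> ('a \<Rightarrow> real) \<Rightarrow> ('a ell2 \<Rightarrow> 'a ell2) \<Rightarrow> bool" where
  "weighted_shift V E lam S \<longleftrightarrow>
     bounded_operator_on (ell2_space V) S \<and>
     (\<forall>u\<in>V. S (basis_vec u) = (\<Sum>v\<in>Chi V E u. lam v *\<^sub>R basis_vec v))"

section \<open>The tree with two branches\<close>

text \<open>\<open>Trunk k\<close> is the vertex \<open>k\<close>, and \<open>Primed i\<close> is the vertex \<open>i'\<close>.\<close>

datatype vertex = Trunk int | Primed nat

definition tree_verts :: "nat \<Rightarrow> nat \<Rightarrow> vertex set" where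
  "tree_verts k0 j0 = {Trunk k | k. k \<le> int j0} \<union> {Primed i | i. 1 \<le> i \<and> i \<le> k0}"

definition tree_edges :: "nat \<Rightarrow> nat \<Rightarrow> (vertex \<times> vertex) set" where
  "tree_edges k0 j0 =
     {(Trunk k, Trunk (k + 1)) | k. k < int j0} \<union> {(Trunk 0, Primed 1)} \<union>
     {(Primed i, Primed (i + 1)) | i. 1 \<le> i \<and> i < k0}"

lemma finite_Chi_tree: "finite (Chi (tree_verts k0 j0) (tree_edges k0 j0) u)"
proof (rule finite_subset)
  show "Chi (tree_verts k0 j0) (tree_edges k0 j0) u \<subseteq>
    (case u of Trunk k \<Rightarrow> {Trunk (k + 1), Primed 1} | Primed i \<Rightarrow> {Primed (i + 1)})"
    by (auto simp: Chi_def tree_edges_def split: vertex.splits)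
qed (auto split: vertex.splits)

end

theory Submission
  imports Defs
begin

text \<open>
  Choose multiples \<open>y\<^sub>m\<close> of \<open>e\<^bsub>-m\<^esub>\<close> with \<open>S y\<^bsub>m+1\<^esub> = y\<^sub>m\<close>, and let \<open>x = \<Sum>m. c\<^sub>m y\<^sub>m\<close> with \<open>c\<^sub>m\<close> decreasing
  very fast. The cyclic vector is \<open>h = x + e\<^bsub>1'\<^esub>\<close>. Since \<open>k\<^sub>0 \<le> j\<^sub>0\<close>, the power \<open>S\<^bsup>j\<^sub>0\<^esup>\<close> kills \<open>e\<^bsub>1'\<^esub>\<close>,
  so \<open>S\<^bsup>n\<^esup> h = S\<^bsup>n\<^esup> x\<close> for \<open>n \<ge> j\<^sub>0\<close>; also \<open>S\<^bsup>j\<^sub>0+1\<^esup>\<close> kills \<open>y\<^sub>0\<close>. Hence, given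
  \<open>S\<^bsup>j\<^sub>0\<^esup> y\<^sub>q\<close> for \<open>q < p\<close>, the vector \<open>S\<^bsup>j\<^sub>0\<^esup> y\<^sub>p\<close> is the limit of \<open>c\<^bsub>n+p\<^esub>\<^bsup>-1\<^esup> S\<^bsup>n+j\<^sub>0\<^esup> h\<close> corrected by
  terms already in the closed orbit span \<open>L\<close>. As \<open>S\<^bsup>j\<^sub>0\<^esup> y\<^bsub>m+j\<^sub>0\<^esub> = y\<^sub>m\<close>, the space \<open>L\<close> contains all
  \<open>e\<^bsub>-m\<^esub>\<close>, therefore \<open>x\<close>, therefore \<open>e\<^bsub>1'\<^esub> = h - x\<close>, and by invariance every basis vector.
\<close>

section \<open>Coordinates, norm and continuity in \<open>ell2\<close>\<close>

lemma ell2_coord_minus: "ell2_coord (f - g) x = ell2_coord f x - ell2_coord g x"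
  unfolding minus_ell2_def plus_ell2.rep_eq uminus_ell2.rep_eq by simp

lemmas ell2_coord_simps = ell2_coord_minus plus_ell2.rep_eq zero_ell2.rep_eq scaleC.rep_eq
  basis_vec.rep_eq

lemma ell2_coord_sum: "ell2_coord (sum f A) x = (\<Sum>a\<in>A. ell2_coord (f a) x)"
  by (induction A rule: infinite_finite_induct) (simp_all add: ell2_coord_simps)

lemma ell2_eqI: "(\<And>x. ell2_coord f x = ell2_coord g x) \<Longrightarrow> f = g"
  by (intro ell2_coord_inject[THEN iffD1] ext)

lemma norm_ell2_squared: "(norm f)\<^sup>2 = (\<Sum>\<^sub>\<infinity>x. (cmod (ell2_coord f x))\<^sup>2)"
  by (simp add: norm_ell2_eq infsum_nonneg)

lemma norm_scaleC: "norm (c *\<^sub>C f) = cmod c * norm f"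
proof -
  have "(norm (c *\<^sub>C f))\<^sup>2 = (cmod c * norm f)\<^sup>2"
    by (simp add: norm_ell2_squared power_mult_distrib scaleC.rep_eq norm_mult infsum_cmult_right')
  then show ?thesis by (simp add: power2_eq_iff_nonneg)
qed

lemma cmod_ell2_coord_le: "cmod (ell2_coord f x) \<le> norm f"
proof -
  have "(\<Sum>y\<in>{x}. (cmod (ell2_coord f y))\<^sup>2) \<le> (norm f)\<^sup>2"
    unfolding norm_ell2_squared by (rule finite_sum_le_infsum[OF ell2_summable]) auto
  then show ?thesis by (simp add: power2_le_iff_abs_le)
qed

lemma continuous_on_ell2_coord: "continuous_on A (\<lambda>f. ell2_coord f x)"
proof (rule continuous_on_subset)
  show "continuous_on UNIV (\<lambda>f :: 'a ell2. ell2_coord f x)"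
    unfolding continuous_on_iff
    by (metis UNIV_I cmod_ell2_coord_le dist_norm ell2_coord_minus le_less_trans)
qed simp

lemma continuous_on_scaleC: "continuous_on A ((*\<^sub>C) c)"
proof (rule continuous_on_subset)
  have eq: "c *\<^sub>C f - c *\<^sub>C g = c *\<^sub>C (f - g)" for f g :: "'a ell2"
    by (rule complex_ell2.scale_right_diff_distrib[symmetric])
  have "(cmod c)-lipschitz_on UNIV ((*\<^sub>C) c :: 'a ell2 \<Rightarrow> _)"
    by (rule lipschitz_onI) (simp_all add: dist_norm eq norm_scaleC)
  then show "continuous_on UNIV ((*\<^sub>C) c :: 'a ell2 \<Rightarrow> _)"
    by (rule lipschitz_on_continuous_on)
qed simp

section \<open>Closed complex subspaces and approximation by basis vectors\<close>

text \<open>A continuous map that sends \<open>A\<close> into \<open>closure A\<close> sends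
  \<open>closure A\<close> there too. For sums this is used twice: first with one summand still in
  \<open>A\<close>, then with both in the closure.\<close>

lemma complex_subspace_closure:
  assumes A: "complex_ell2.subspace A"
  shows "complex_ell2.subspace (closure A)"
proof (rule complex_ell2.subspaceI)
  show "0 \<in> closure A"
    using complex_ell2.subspace_0[OF A] closure_subset by blast
  show "c *\<^sub>C f \<in> closure A" if "f \<in> closure A" for c f
  proof -
    have "(*\<^sub>C) c ` closure A \<subseteq> closure A"
      by (rule image_closure_subset[OF continuous_on_scaleC])
        (use complex_ell2.subspace_scale[OF A] closure_subset in auto)
    then show ?thesis using that by auto
  qed
  have 1: "f + g \<in> closure A" if "f \<in> closure A" "g \<in> A" for f g
  proof -
    have "(\<lambda>f. f + g) ` closure A \<subseteq> closure A"
      by (rule image_closure_subset)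
        (use complex_ell2.subspace_add[OF A] closure_subset that in
          \<open>auto intro!: continuous_intros\<close>)
    then show ?thesis using that by auto
  qed
  show "f + g \<in> closure A" if "f \<in> closure A" "g \<in> closure A" for f g
  proof -
    have "(+) f ` closure A \<subseteq> closure A"
      by (rule image_closure_subset) (use 1 that in \<open>auto intro!: continuous_intros\<close>)
    then show ?thesis using that by auto
  qed
qed

lemma complex_subspace_ell2_space: "complex_ell2.subspace (ell2_space V)"
  by (rule complex_ell2.subspaceI) (simp_all add: ell2_space_def ell2_coord_simps)

lemma closed_ell2_space: "closed (ell2_space V)"
proof -
  have "ell2_space V = (\<Inter>x\<in>-V. {f. ell2_coord f x = 0})"
    by (auto simp: ell2_space_def)
  moreover have "closed {f. ell2_coord f x = 0}" for x :: 'a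
    by (intro closed_Collect_eq continuous_on_ell2_coord continuous_on_const)
  ultimately show ?thesis by auto
qed

lemma basis_vec_in_ell2_space: "v \<in> V \<Longrightarrow> basis_vec v \<in> ell2_space V"
  by (auto simp: ell2_space_def basis_vec.rep_eq)

text \<open>Cutting \<open>f\<close> down to finitely many coordinates leaves an error whose squared
  norm is a tail of the convergent sum of squares.\<close>

lemma ell2_space_subset_closure_span: "ell2_space V \<subseteq> closure (complex_span (basis_vec ` V))"
proof
  fix f assume f: "f \<in> ell2_space V"
  let ?q = "\<lambda>x. (cmod (ell2_coord f x))\<^sup>2"
  show "f \<in> closure (complex_span (basis_vec ` V))"
    unfolding closure_approachable
  proof (intro allI impI)
    fix \<epsilon> :: real assume "\<epsilon> > 0"
    then obtain F where F: "finite F" "dist (sum ?q F) (infsum ?q UNIV) \<le> \<epsilon>\<^sup>2 / 2"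
      using infsum_finite_approximation[OF ell2_summable, of "\<epsilon>\<^sup>2 / 2" f] by auto
    define g where "g = (\<Sum>u\<in>F. ell2_coord f u *\<^sub>C basis_vec u)"
    have "g \<in> complex_span (basis_vec ` V)"
      unfolding g_def
    proof (rule complex_ell2.span_sum)
      \<comment> \<open>\<open>F\<close> need not lie inside \<open>V\<close>, but \<open>f\<close>
        vanishes off \<open>V\<close>, so the extra terms are zero.\<close>
      fix u
      show "ell2_coord f u *\<^sub>C basis_vec u \<in> complex_span (basis_vec ` V)"
      proof (cases "u \<in> V")
        case True
        then show ?thesis by (intro complex_ell2.span_scale complex_ell2.span_base) auto
      next
        case False
        then show ?thesis using f by (simp add: ell2_space_def complex_ell2.span_zero)
      qed
    qed
    moreover have "dist g f < \<epsilon>"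
    proof -
      have coord: "ell2_coord (f - g) x = (if x \<in> F then 0 else ell2_coord f x)" for x
        using F(1) by (simp add: g_def ell2_coord_simps ell2_coord_sum if_distrib cong: if_cong)
      have "(norm (f - g))\<^sup>2 = infsum ?q (UNIV - F)"
        unfolding norm_ell2_squared by (rule infsum_cong_neutral) (auto simp: coord)
      also have "\<dots> = infsum ?q UNIV - sum ?q F"
        using F(1) by (subst infsum_Diff) (auto intro: ell2_summable)
      also have "\<dots> \<le> \<epsilon>\<^sup>2 / 2"
        using F(2) unfolding dist_real_def by linarith
      also have "\<dots> < \<epsilon>\<^sup>2" using \<open>\<epsilon> > 0\<close> by simp
      finally show ?thesis
        using \<open>\<epsilon> > 0\<close> by (simp add: dist_norm norm_minus_commute power_less_imp_less_base)
    qed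
    ultimately show "\<exists>g\<in>complex_span (basis_vec ` V). dist g f < \<epsilon>" by blast
  qed
qed

lemma ell2_space_subsetI:
  assumes "complex_ell2.subspace L" "closed L" "\<And>v. v \<in> V \<Longrightarrow> basis_vec v \<in> L"
  shows "ell2_space V \<subseteq> L"
proof -
  have "complex_span (basis_vec ` V) \<subseteq> L"
    using assms by (intro complex_ell2.span_minimal) auto
  then show ?thesis
    using ell2_space_subset_closure_span closure_minimal assms(2) by blast
qed

text \<open>Placing \<open>b m\<close> at \<open>e m\<close> and zero elsewhere gives squares
  dominated by a geometric series with ratio 1/4 and sum \<open>4/3 * C\<^sup>2\<close>, which is at
  most \<open>(2 * C)\<^sup>2\<close>. This serves to build \<open>x\<close> and its tails with
  explicit norm bounds.\<close>

lemma ell2_geometric_sequence: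
  fixes b :: "nat \<Rightarrow> complex"
  assumes e: "inj e" and b: "\<And>m. cmod (b m) \<le> C / 2 ^ m"
  obtains z where "\<And>m. ell2_coord z (e m) = b m" "z \<in> ell2_space (range e)" "norm z \<le> 2 * C"
proof -
  have C: "C \<ge> 0" using order_trans[OF norm_ge_zero b[of 0]] by simp
  define f where "f x = (if x \<in> range e then b (inv e x) else 0)" for x
  have fe: "f (e m) = b m" for m using e by (simp add: f_def)
  have le: "(cmod (b m))\<^sup>2 \<le> C\<^sup>2 * (1 / 4) ^ m" for m
  proof -
    have "(cmod (b m))\<^sup>2 \<le> (C / 2 ^ m)\<^sup>2" using b by (intro power_mono) auto
    moreover have "(2 ^ m)\<^sup>2 = (4 :: real) ^ m"
      by (simp add: power2_eq_square flip: power_mult_distrib)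
    ultimately show ?thesis by (simp add: power_divide)
  qed
  have "(\<lambda>m. C\<^sup>2 * (1 / 4) ^ m) sums (C\<^sup>2 * (1 / (1 - 1 / 4)))"
    by (intro sums_mult geometric_sums) simp
  then have geo: "((\<lambda>m. C\<^sup>2 * (1 / 4) ^ m) has_sum (C\<^sup>2 * (1 / (1 - 1 / 4)))) UNIV"
    by (rule sums_nonneg_imp_has_sum) simp
  have sb: "(\<lambda>m. (cmod (b m))\<^sup>2) summable_on UNIV"
    by (rule summable_on_comparison_test[OF has_sum_imp_summable[OF geo]]) (use le in auto)
  have "(\<lambda>x. (cmod (f x))\<^sup>2) summable_on range e"
    using sb e by (subst summable_on_reindex) (auto simp: o_def fe)
  then have sf: "(\<lambda>x. (cmod (f x))\<^sup>2) summable_on UNIV"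
    by (rule summable_on_cong_neutral[THEN iffD1, rotated -1]) (auto simp: f_def)
  define z where "z = Abs_ell2 f"
  have z: "ell2_coord z = f" using sf by (simp add: z_def Abs_ell2_inverse)
  have "(norm z)\<^sup>2 = infsum (\<lambda>x. (cmod (f x))\<^sup>2) (range e)"
    unfolding norm_ell2_squared z by (rule infsum_cong_neutral) (auto simp: f_def)
  also have "\<dots> = infsum (\<lambda>m. (cmod (b m))\<^sup>2) UNIV"
    using e by (subst infsum_reindex) (auto simp: o_def fe)
  also have "\<dots> \<le> infsum (\<lambda>m. C\<^sup>2 * (1 / 4) ^ m) UNIV"
    using le sb geo by (intro infsum_mono) (auto intro: has_sum_imp_summable)
  also have "\<dots> = C\<^sup>2 * (1 / (1 - 1 / 4))" using geo by (rule infsumI)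
  also have "\<dots> \<le> (2 * C)\<^sup>2" by (simp add: power_mult_distrib)
  finally have "norm z \<le> 2 * C" using C by (simp only: power2_le_imp_le mult_nonneg_nonneg zero_le_numeral)
  with fe show ?thesis
    by (intro that) (auto simp: z ell2_space_def f_def)
qed

section \<open>Bounded operators, their powers and invariant orbit closures\<close>

text \<open>The definition puts no sign condition on \<open>K\<close>; the estimates for powers need
  a nonnegative bound, hence \<open>max K 0\<close>.\<close>

lemma bounded_operator_onE:
  assumes "bounded_operator_on H S"
  obtains K where "K \<ge> 0" "\<forall>f\<in>H. norm (S f) \<le> K * norm f"
proof -
  obtain K where K: "\<forall>f\<in>H. norm (S f) \<le> K * norm f"
    using assms unfolding bounded_operator_on_def by blast
  have "norm (S f) \<le> max K 0 * norm f" if "f \<in> H" for f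
    by (rule order_trans[OF bspec[OF K that]]) (simp add: mult_right_mono)
  then show ?thesis by (intro that[of "max K 0"]) auto
qed

lemma bounded_operator_on_funpow:
  assumes "bounded_operator_on H S" "complex_ell2.subspace H"
    "\<forall>f\<in>H. norm (S f) \<le> K * norm f" "K \<ge> 0"
  shows "f \<in> H \<Longrightarrow> (S ^^ n) f \<in> H"
    and "f \<in> H \<Longrightarrow> g \<in> H \<Longrightarrow> (S ^^ n) (f + g) = (S ^^ n) f + (S ^^ n) g"
    and "f \<in> H \<Longrightarrow> (S ^^ n) (c *\<^sub>C f) = c *\<^sub>C (S ^^ n) f"
    and "f \<in> H \<Longrightarrow> norm ((S ^^ n) f) \<le> K ^ n * norm f"
proof -
  show mem: "f \<in> H \<Longrightarrow> (S ^^ n) f \<in> H" for f n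
    using assms(1) by (induction n) (auto simp: bounded_operator_on_def)
  show "f \<in> H \<Longrightarrow> g \<in> H \<Longrightarrow> (S ^^ n) (f + g) = (S ^^ n) f + (S ^^ n) g"
    using assms(1) mem by (induction n) (auto simp: bounded_operator_on_def)
  show "f \<in> H \<Longrightarrow> (S ^^ n) (c *\<^sub>C f) = c *\<^sub>C (S ^^ n) f"
    using assms(1) mem by (induction n) (auto simp: bounded_operator_on_def)
  show "f \<in> H \<Longrightarrow> norm ((S ^^ n) f) \<le> K ^ n * norm f"
  proof (induction n)
    case (Suc n)
    have "norm ((S ^^ Suc n) f) \<le> K * norm ((S ^^ n) f)" using assms(3) mem Suc.prems by simp
    also have "\<dots> \<le> K * (K ^ n * norm f)" using Suc assms(4) by (intro mult_left_mono) auto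
    finally show ?case by (simp add: mult.assoc)
  qed simp
qed

lemma bounded_operator_on_continuous:
  assumes S: "bounded_operator_on H S" and H: "complex_ell2.subspace H"
  shows "continuous_on H S"
proof -
  obtain K where "K \<ge> 0" "\<forall>f\<in>H. norm (S f) \<le> K * norm f"
    using bounded_operator_onE[OF S] by blast
  moreover have "S f - S g = S (f - g)" if "f \<in> H" "g \<in> H" for f g
  proof -
    have "S ((f - g) + g) = S (f - g) + S g"
      using S that complex_ell2.subspace_diff[OF H] unfolding bounded_operator_on_def by blast
    then show ?thesis by simp
  qed
  ultimately have "K-lipschitz_on H S"
    by (intro lipschitz_onI) (auto simp: dist_norm complex_ell2.subspace_diff[OF H])
  then show ?thesis by (rule lipschitz_on_continuous_on)
qed

text \<open>Invariance holds on the span by linearity and passes to the closure by continuity. Since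
  \<open>S\<close> is controlled only on \<open>H\<close>, the inclusion of \<open>L\<close> in
  \<open>H\<close> comes first.\<close>

lemma orbit_closure_invariant:
  assumes S: "bounded_operator_on H S" and H: "complex_ell2.subspace H" "closed H" and h: "h \<in> H"
  defines "L \<equiv> closure (complex_span {(S ^^ n) h | n. True})"
  shows "L \<subseteq> H" "f \<in> L \<Longrightarrow> S f \<in> L"
proof -
  let ?A = "complex_span {(S ^^ n) h | n. True}"
  have pow_h: "(S ^^ n) h \<in> H" for n
    using S h by (induction n) (auto simp: bounded_operator_on_def)
  then have AH: "?A \<subseteq> H"
    by (intro complex_ell2.span_minimal) (auto intro: H)
  then show LH: "L \<subseteq> H" unfolding L_def using H by (intro closure_minimal)
  have A: "f \<in> H \<and> S f \<in> ?A" if "f \<in> ?A" for f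
    using that
  proof (induction rule: complex_ell2.span_induct_alt)
    case base
    \<comment> \<open>Writing \<open>0\<close> as a multiple of \<open>h\<close> gets
      \<open>S 0 = 0\<close> from homogeneity.\<close>
    have "S (0 *\<^sub>C h) = 0 *\<^sub>C S h" using S h unfolding bounded_operator_on_def by blast
    then show ?case by (simp add: complex_ell2.span_zero complex_ell2.subspace_0[OF H(1)])
  next
    case (step c f g)
    then obtain n where f: "f = (S ^^ n) h" by auto
    have fH: "f \<in> H" unfolding f by (rule pow_h)
    have gH: "g \<in> H" and Sg: "S g \<in> ?A" using step by auto
    have cfH: "c *\<^sub>C f \<in> H" by (rule complex_ell2.subspace_scale[OF H(1) fH])
    have "S (c *\<^sub>C f + g) = c *\<^sub>C S f + S g"
      using S fH gH cfH unfolding bounded_operator_on_def by simp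
    moreover have "S f \<in> ?A"
      unfolding f by (rule complex_ell2.span_base) (auto intro!: exI[of _ "Suc n"])
    ultimately show ?case
      using Sg complex_ell2.subspace_add[OF H(1) cfH gH]
      by (simp add: complex_ell2.span_add complex_ell2.span_scale)
  qed
  have "S ` L \<subseteq> L"
    unfolding L_def
  proof (rule image_closure_subset)
    show "continuous_on (closure ?A) S"
      using bounded_operator_on_continuous[OF S H(1)] LH
      by (auto simp: L_def intro: continuous_on_subset)
  qed (use A closure_subset in auto)
  then show "f \<in> L \<Longrightarrow> S f \<in> L" by auto
qed

section \<open>A vector whose late orbit generates a backward chain\<close>

text \<open>The closed subspace \<open>L\<close> is arbitrary and only powers
  \<open>n \<ge> d\<close> of \<open>S\<close> on \<open>x\<close> are required in it: in the
  application \<open>L\<close> is the orbit closure of a perturbation of \<open>x\<close> by a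
  vector that \<open>S ^^ d\<close> kills, so nothing is known about the lower powers.\<close>

lemma backward_chain_cyclic:
  fixes e :: "nat \<Rightarrow> 'a" and w :: "nat \<Rightarrow> real"
  assumes S: "bounded_operator_on (ell2_space V) S"
    and e: "inj e" "range e \<subseteq> V"
    and w: "\<And>m. w m > 0"
    and Se: "\<And>m. S (basis_vec (e (Suc m))) = w m *\<^sub>R basis_vec (e m)"
    and nil: "(S ^^ Suc d) (basis_vec (e 0)) = 0"
  obtains x where "x \<in> ell2_space (range e)"
    and "\<And>L m. complex_ell2.subspace L \<Longrightarrow> closed L \<Longrightarrow> (\<And>n. n \<ge> d \<Longrightarrow> (S ^^ n) x \<in> L)
           \<Longrightarrow> basis_vec (e m) \<in> L"
proof -
  let ?H = "ell2_space V"
  note H = complex_subspace_ell2_space[of V]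
  obtain K where K_nonneg: "K \<ge> 0" and K: "\<forall>f\<in>?H. norm (S f) \<le> K * norm f"
    using bounded_operator_onE[OF S] by blast
  note pow = bounded_operator_on_funpow[OF S H K K_nonneg]
  define R where "R = K + 1"  \<comment> \<open>powers of \<open>R\<close> beat those of \<open>S\<close>\<close>
  have R: "R \<ge> 1" "K < R" using K_nonneg by (auto simp: R_def)
  \<comment> \<open>Dividing by the weights makes \<open>S\<close> an exact backward shift on
    \<open>y\<close>. The empty product gives \<open>y 0 = basis_vec (e 0)\<close>, so
    \<open>nil\<close> applies to \<open>y 0\<close> directly.\<close>
  define \<alpha> where "\<alpha> m = (\<Prod>i<m. 1 / w i)" for m
  have \<alpha>_pos: "\<alpha> m > 0" for m unfolding \<alpha>_def using w by (intro prod_pos) auto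
  define y where "y m = of_real (\<alpha> m) *\<^sub>C basis_vec (e m)" for m
  have eH: "basis_vec (e m) \<in> ?H" for m using e(2) by (auto intro: basis_vec_in_ell2_space)
  have yH: "y m \<in> ?H" for m
    unfolding y_def by (intro complex_ell2.subspace_scale H eH)
  have Sy: "S (y (Suc m)) = y m" for m
  proof -
    have "S (y (Suc m)) = of_real (\<alpha> (Suc m)) *\<^sub>C (w m *\<^sub>R basis_vec (e m))"
      using S eH unfolding y_def Se[symmetric] bounded_operator_on_def by blast
    then show ?thesis using w[of m] by (simp add: y_def \<alpha>_def scaleR_ell2_def)
  qed
  have Spow_y: "(S ^^ n) (y (m + n)) = y m" for m n
    by (induction n) (simp_all add: funpow_swap1 Sy del: funpow.simps(2), simp add: funpow_swap1 Sy)
  have Spow_0: "(S ^^ n) 0 = 0" for n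
    using pow(3)[OF complex_ell2.subspace_0[OF H], of n 0] by simp
  \<comment> \<open>Here \<open>m\<close> steps lead down to \<open>y 0\<close>,
    \<open>Suc d\<close> more kill it, and the remaining \<open>k\<close> act on zero.\<close>
  have Spow_y_0: "(S ^^ (n + d)) (y m) = 0" if "m < n" for m n
  proof -
    obtain k where k: "n + d = k + (Suc d + m)" using \<open>m < n\<close> by (metis add.commute add.left_commute add_Suc less_imp_Suc_add add_Suc_right)
    have "y 0 = basis_vec (e 0)" by (simp add: y_def \<alpha>_def)
    then show ?thesis
      using Spow_y[of m 0] nil Spow_0 by (simp only: k funpow_add o_apply add_0)
  qed
  \<comment> \<open>The factor \<open>R ^ i\<close> outweighs the growth of powers of
    \<open>S\<close>, \<open>2 ^ Suc i\<close> makes the series converge, and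
    \<open>1 + \<alpha> (Suc i)\<close> absorbs the norm of \<open>y (Suc i)\<close> while staying
    above 1, so that \<open>c\<close> decreases.\<close>
  define c where "c m = (\<Prod>i<m. 1 / (R ^ i * 2 ^ Suc i * (1 + \<alpha> (Suc i))))" for m
  have c_pos: "c m > 0" for m
    unfolding c_def using R \<alpha>_pos by (intro prod_pos) (auto simp: add_pos_pos)
  have c_Suc: "c (Suc m) = c m / (R ^ m * 2 ^ Suc m * (1 + \<alpha> (Suc m)))" for m
    by (simp add: c_def)
  have c_dec: "c (Suc m) \<le> c m" for m
  proof -
    have "1 * 1 * 1 \<le> R ^ m * 2 ^ Suc m * (1 + \<alpha> (Suc m))"
      using R \<alpha>_pos[of "Suc m"] by (intro mult_mono one_le_power) (auto intro: one_le_power)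
    then show ?thesis
      unfolding c_Suc using c_pos[of m] divide_left_mono[of 1 _ "c m"] by simp
  qed
  have c_anti: "c n \<le> c m" if "m \<le> n" for m n
    using lift_Suc_antimono_le[of c, OF c_dec that] .
  \<comment> \<open>Every coefficient beyond \<open>N\<close> is small relative to
    \<open>c N\<close> itself, with \<open>R ^ N\<close> to spare; dividing by \<open>c N\<close>
    later is therefore harmless.\<close>
  have c_bound: "c m * \<alpha> m \<le> c N / R ^ N / 2 ^ m" if Nm: "N < m" for N m
  proof -
    obtain k where m: "m = Suc k" "N \<le> k" using Nm by (cases m) auto
    have "c m * \<alpha> m = c k / R ^ k / 2 ^ m * (\<alpha> m / (1 + \<alpha> m))"
      by (simp add: m c_Suc)
    also have "\<dots> \<le> c k / R ^ k / 2 ^ m * 1"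
      using c_pos[of k] R \<alpha>_pos[of m] by (intro mult_left_mono) auto
    also have "\<dots> \<le> c N / R ^ N / 2 ^ m"
      using c_pos[of N] R c_anti[OF m(2)] m(2)
      by (auto intro!: divide_right_mono frac_le power_increasing)
    finally show ?thesis .
  qed
  \<comment> \<open>the tails \<open>\<Sum>m\<ge>N. c\<^sub>m y\<^sub>m\<close>\<close>
  have "\<exists>z. z \<in> ell2_space (range e)
      \<and> (\<forall>m. ell2_coord z (e m) = (if N \<le> m then of_real (c m * \<alpha> m) else 0))
      \<and> (\<forall>M. N = Suc M \<longrightarrow> norm z \<le> 2 * (c M / R ^ M))" for N
  proof -
    \<comment> \<open>For \<open>N = 0\<close> there is no preceding coefficient to compare with:
      \<open>\<alpha> 0\<close> covers the term \<open>m = 0\<close>, and 1 covers the others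
      through \<open>c_bound\<close> at 0. Only the norms of the later tails matter
      afterwards.\<close>
    define C where "C = (case N of 0 \<Rightarrow> \<alpha> 0 + 1 | Suc M \<Rightarrow> c M / R ^ M)"
    have "cmod (if N \<le> m then of_real (c m * \<alpha> m) else 0) \<le> C / 2 ^ m" for m
    proof (cases "N \<le> m")
      case False
      have "C \<ge> 0" using c_pos \<alpha>_pos R
        by (auto simp: C_def less_imp_le add_nonneg_nonneg split: nat.split)
      with False show ?thesis by simp
    next
      case True
      have "c m * \<alpha> m \<le> C / 2 ^ m"
      proof (cases N)
        case (Suc M)
        then show ?thesis using c_bound[of M m] True by (simp add: C_def)
      next
        case 0
        show ?thesis
        proof (cases m)
          case (Suc k)
          have "c 0 = 1" by (simp add: c_def)
          then have "c m * \<alpha> m \<le> 1 / 2 ^ m" using c_bound[of 0 m] Suc by simp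
          also have "\<dots> \<le> C / 2 ^ m"
            using 0 \<alpha>_pos[of 0] by (intro divide_right_mono) (auto simp: C_def)
          finally show ?thesis .
        qed (simp add: 0 C_def c_def)
      qed
      then show ?thesis using True c_pos[of m] \<alpha>_pos[of m] by (simp add: norm_mult)
    qed
    then obtain z where
      "\<And>m. ell2_coord z (e m) = (if N \<le> m then of_real (c m * \<alpha> m) else 0)"
      "z \<in> ell2_space (range e)" "norm z \<le> 2 * C"
      by (rule ell2_geometric_sequence[OF e(1)]) blast
    then show ?thesis by (intro exI[of _ z]) (auto simp: C_def)
  qed
  then obtain z where z_range: "\<And>N. z N \<in> ell2_space (range e)"
    and z_coord: "\<And>N m. ell2_coord (z N) (e m) = (if N \<le> m then of_real (c m * \<alpha> m) else 0)"
    and z_norm: "\<And>N. norm (z (Suc N)) \<le> 2 * (c N / R ^ N)"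
    by metis
  have zH: "z N \<in> ?H" for N using z_range e(2) by (auto simp: ell2_space_def)
  have z_rec: "z N = of_real (c N) *\<^sub>C y N + z (Suc N)" for N
  proof (rule ell2_eqI)
    fix v
    show "ell2_coord (z N) v = ell2_coord (of_real (c N) *\<^sub>C y N + z (Suc N)) v"
    proof (cases "v \<in> range e")
      case True
      then show ?thesis using e(1) by (auto simp: ell2_coord_simps z_coord y_def inj_eq)
    next
      case False
      then show ?thesis using z_range by (auto simp: ell2_coord_simps ell2_space_def y_def)
    qed
  qed
  have S_z_rec: "(S ^^ n) (z N) = of_real (c N) *\<^sub>C (S ^^ n) (y N) + (S ^^ n) (z (Suc N))" for n N
  proof -
    have "of_real (c N) *\<^sub>C y N \<in> ?H" using complex_ell2.subspace_scale[OF H yH] .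
    then show ?thesis using pow(2)[OF _ zH] pow(3)[OF yH] by (metis z_rec)
  qed
  show ?thesis
  proof (rule that)
    show "z 0 \<in> ell2_space (range e)" by (rule z_range)
    fix L m
    assume L: "complex_ell2.subspace L" "closed L" and Lz: "\<And>n. n \<ge> d \<Longrightarrow> (S ^^ n) (z 0) \<in> L"
    have "(S ^^ d) (y p) \<in> L" for p
    proof (induction p rule: less_induct)
      case (less p)
      \<comment> \<open>For \<open>i < n\<close> the vector is killed; otherwise it equals
        \<open>(S ^^ d) (y q)\<close> with \<open>q < p\<close>, an earlier case of the strong
        induction.\<close>
      have Sy_L: "(S ^^ (n + d)) (y i) \<in> L" if "i < n + p" for n i
      proof (cases "i < n")
        case True
        then show ?thesis using Spow_y_0 complex_ell2.subspace_0[OF L(1)] by simp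
      next
        case False
        then obtain q where q: "i = q + n" by (metis add.commute le_Suc_ex not_less)
        have "(S ^^ (n + d)) (y i) = (S ^^ d) (y q)"
          using Spow_y[of n q] by (simp add: q add.commute[of n d] funpow_add)
        then show ?thesis using less.IH[of q] that q by simp
      qed
      \<comment> \<open>The head terms of \<open>z 0\<close> are peeled off one by one; each has
        index below \<open>n + p\<close>, so \<open>Sy_L\<close> puts its image in
        \<open>L\<close>.\<close>
      have Sz_L: "(S ^^ (n + d)) (z N) \<in> L" if "N \<le> n + p" for n N
        using that
      proof (induction N)
        case 0
        then show ?case using Lz by simp
      next
        case (Suc N)
        have "(S ^^ (n + d)) (z N) - of_real (c N) *\<^sub>C (S ^^ (n + d)) (y N) \<in> L"
          using Suc Sy_L by (intro complex_ell2.subspace_diff complex_ell2.subspace_scale L) auto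
        then show ?case by (simp add: S_z_rec[of _ N])
      qed
      \<comment> \<open>modulo \<open>L\<close>, the vector \<open>S\<^bsup>n+d\<^esup> (z 0) / c\<^bsub>n+p\<^esub>\<close> is \<open>S\<^bsup>d\<^esup> y\<^sub>p\<close> plus this vanishing tail\<close>
      define r where "r n = of_real (1 / c (n + p)) *\<^sub>C (S ^^ (n + d)) (z (Suc (n + p)))" for n
      have "(S ^^ d) (y p) + r n \<in> L" for n
      proof -
        have "(S ^^ (n + d)) (y (n + p)) = (S ^^ d) (y p)"
          using Spow_y[of n p] by (simp add: add.commute[of n] funpow_add)
        then have "of_real (1 / c (n + p)) *\<^sub>C (S ^^ (n + d)) (z (n + p)) = (S ^^ d) (y p) + r n"
          using c_pos[of "n + p"]
          by (simp add: S_z_rec[of _ "n + p"] r_def complex_ell2.scale_right_distrib)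
        then show ?thesis
          using complex_ell2.subspace_scale[OF L(1) Sz_L[of "n + p" n]] by (metis order_refl)
      qed
      \<comment> \<open>The factor \<open>c (n + p)\<close> in the tail norm cancels the division in
        \<open>r\<close>, and what remains decays like \<open>(K / R) ^ n\<close>.\<close>
      moreover have "r \<longlonglongrightarrow> 0"
      proof (rule Lim_null_comparison)
        show "\<forall>\<^sub>F n in sequentially. norm (r n) \<le> 2 * K ^ d * (K / R) ^ n"
        proof (intro always_eventually allI)
          fix n
          have "norm (r n) \<le> 1 / c (n + p) * (K ^ (n + d) * norm (z (Suc (n + p))))"
            unfolding r_def norm_scaleC norm_of_real using c_pos[of "n + p"] pow(4)[OF zH]
            by (intro mult_mono) auto
          also have "\<dots> \<le> 1 / c (n + p) * (K ^ (n + d) * (2 * (c (n + p) / R ^ (n + p))))"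
            using c_pos[of "n + p"] K_nonneg z_norm by (intro mult_left_mono) auto
          also have "\<dots> = 2 * K ^ (n + d) / R ^ (n + p)"
            using c_pos[of "n + p"] by simp
          also have "\<dots> \<le> 2 * K ^ (n + d) / R ^ n"
            using R K_nonneg by (intro divide_left_mono power_increasing) auto
          also have "\<dots> = 2 * K ^ d * (K / R) ^ n"
            by (simp add: power_add power_divide)
          finally show "norm (r n) \<le> 2 * K ^ d * (K / R) ^ n" .
        qed
        show "(\<lambda>n. 2 * K ^ d * (K / R) ^ n) \<longlonglongrightarrow> 0"
          using R K_nonneg by (intro tendsto_mult_right_zero LIMSEQ_power_zero) auto
      qed
      then have "(\<lambda>n. (S ^^ d) (y p) + r n) \<longlonglongrightarrow> (S ^^ d) (y p) + 0"
        by (intro tendsto_intros)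
      ultimately show ?case
        using closed_sequentially[OF L(2)] by (metis add_0_right)
    qed
    then have "y m \<in> L" using Spow_y by metis
    then have "of_real (1 / \<alpha> m) *\<^sub>C y m \<in> L"
      by (rule complex_ell2.subspace_scale[OF L(1)])
    then show "basis_vec (e m) \<in> L" using \<alpha>_pos[of m] by (simp add: y_def)
  qed
qed

section \<open>The tree: nilpotency on both branches and recovery of all basis vectors\<close>

theorem theorem6p3:
  fixes k0 j0 :: nat
    and lam :: "vertex \<Rightarrow> real"
    and S :: "vertex ell2 \<Rightarrow> vertex ell2"
  assumes "1 \<le> k0" and "k0 \<le> j0"
    and "\<And>v. v \<in> tree_verts k0 j0 \<Longrightarrow> 0 < lam v"
    and "bdd_above (lam ` tree_verts k0 j0)"
    and "weighted_shift (tree_verts k0 j0) (tree_edges k0 j0) lam S"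
  shows "cyclic_on (ell2_space (tree_verts k0 j0)) S"
proof -
  let ?V = "tree_verts k0 j0" and ?E = "tree_edges k0 j0"
  let ?H = "ell2_space ?V"
  note H = complex_subspace_ell2_space[of ?V]
  have S: "bounded_operator_on ?H S"
    and Sb: "\<And>u. u \<in> ?V \<Longrightarrow> S (basis_vec u) = (\<Sum>v\<in>Chi ?V ?E u. lam v *\<^sub>R basis_vec v)"
    using assms(5) by (auto simp: weighted_shift_def)
  obtain K where "K \<ge> 0" "\<forall>f\<in>?H. norm (S f) \<le> K * norm f"
    using bounded_operator_onE[OF S] by blast
  note pow = bounded_operator_on_funpow[OF S H this(2,1)]
  have trunk_V: "Trunk k \<in> ?V \<longleftrightarrow> k \<le> int j0" for k by (auto simp: tree_verts_def)
  have primed_V: "Primed i \<in> ?V \<longleftrightarrow> 1 \<le> i \<and> i \<le> k0" for i by (auto simp: tree_verts_def)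
  have S_0: "S (basis_vec (Trunk 0)) = lam (Trunk 1) *\<^sub>R basis_vec (Trunk 1)
      + lam (Primed 1) *\<^sub>R basis_vec (Primed 1)"
  proof -
    have "Chi ?V ?E (Trunk 0) = {Trunk 1, Primed 1}"
      using assms(1,2) by (auto simp: Chi_def tree_edges_def tree_verts_def)
    then show ?thesis by (simp add: Sb trunk_V)
  qed
  have S_trunk: "S (basis_vec (Trunk k)) = lam (Trunk (k + 1)) *\<^sub>R basis_vec (Trunk (k + 1))"
    if "k < int j0" "k \<noteq> 0" for k
  proof -
    have "Chi ?V ?E (Trunk k) = {Trunk (k + 1)}"
      using that by (auto simp: Chi_def tree_edges_def tree_verts_def)
    then show ?thesis using that by (simp add: Sb trunk_V)
  qed
  have S_trunk_end: "S (basis_vec (Trunk (int j0))) = 0"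
  proof -
    have "Chi ?V ?E (Trunk (int j0)) = {}"
      using assms(1,2) by (auto simp: Chi_def tree_edges_def tree_verts_def)
    then show ?thesis by (simp add: Sb trunk_V)
  qed
  have S_primed: "S (basis_vec (Primed i)) = lam (Primed (i + 1)) *\<^sub>R basis_vec (Primed (i + 1))"
    if "1 \<le> i" "i < k0" for i
  proof -
    have "Chi ?V ?E (Primed i) = {Primed (i + 1)}"
      using that by (auto simp: Chi_def tree_edges_def tree_verts_def)
    then show ?thesis using that by (simp add: Sb primed_V)
  qed
  have S_primed_end: "S (basis_vec (Primed k0)) = 0"
  proof -
    have "Chi ?V ?E (Primed k0) = {}"
      by (auto simp: Chi_def tree_edges_def tree_verts_def)
    then show ?thesis using assms(1) by (simp add: Sb primed_V)
  qed
  have pow_0: "(S ^^ n) 0 = 0" for n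
    using pow(3)[OF complex_ell2.subspace_0[OF H], of n 0] by simp
  have pow_scale: "(S ^^ n) (r *\<^sub>R f) = r *\<^sub>R (S ^^ n) f" if "f \<in> ?H" for n r f
    using pow(3)[OF that] by (simp add: scaleR_ell2_def)
  note bH = basis_vec_in_ell2_space[of _ ?V]
  \<comment> \<open>From \<open>Primed i\<close> only \<open>k0 - i\<close> further vertices follow,
    so one more application reaches zero.\<close>
  have nil_primed: "(S ^^ n) (basis_vec (Primed i)) = 0" if "1 \<le> i" "i \<le> k0" "k0 < n + i" for n i
    using that
  proof (induction n arbitrary: i)
    case (Suc n)
    show ?case
    proof (cases "i = k0")
      case True
      then show ?thesis by (simp only: funpow_Suc_right o_apply S_primed_end pow_0)
    next
      case False
      then have "(S ^^ Suc n) (basis_vec (Primed i))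
          = lam (Primed (i + 1)) *\<^sub>R (S ^^ n) (basis_vec (Primed (i + 1)))"
        using Suc.prems unfolding funpow_Suc_right o_apply
        by (subst S_primed) (auto intro!: pow_scale bH simp: primed_V)
      then show ?thesis using Suc.IH[of "i + 1"] Suc.prems False by simp
    qed
  qed simp
  \<comment> \<open>Starting at \<open>1 \<le> k\<close> keeps the path clear of the branching
    vertex.\<close>
  have nil_trunk: "(S ^^ n) (basis_vec (Trunk k)) = 0"
    if "1 \<le> k" "k \<le> int j0" "int j0 < int n + k" for n k
    using that
  proof (induction n arbitrary: k)
    case (Suc n)
    show ?case
    proof (cases "k = int j0")
      case True
      then show ?thesis by (simp only: funpow_Suc_right o_apply S_trunk_end pow_0)
    next
      case False
      then have "(S ^^ Suc n) (basis_vec (Trunk k))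
          = lam (Trunk (k + 1)) *\<^sub>R (S ^^ n) (basis_vec (Trunk (k + 1)))"
        using Suc.prems unfolding funpow_Suc_right o_apply
        by (subst S_trunk) (auto intro!: pow_scale bH simp: trunk_V)
      then show ?thesis using Suc.IH[of "k + 1"] Suc.prems False by simp
    qed
  qed simp
  \<comment> \<open>One step splits \<open>Trunk 0\<close> into both branches;
    \<open>S ^^ j0\<close> then kills the trunk part by its length and the primed part because
    \<open>k0 \<le> j0\<close>.\<close>
  have nil: "(S ^^ Suc j0) (basis_vec (Trunk 0)) = 0"
  proof -
    have b: "basis_vec (Trunk 1) \<in> ?H" "basis_vec (Primed 1) \<in> ?H"
      using assms(1,2) by (auto intro!: bH simp: trunk_V primed_V)
    then have "lam (Trunk 1) *\<^sub>R basis_vec (Trunk 1) \<in> ?H" "lam (Primed 1) *\<^sub>R basis_vec (Primed 1) \<in> ?H"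
      by (auto simp: scaleR_ell2_def intro: complex_ell2.subspace_scale[OF H])
    then have "(S ^^ Suc j0) (basis_vec (Trunk 0)) = lam (Trunk 1) *\<^sub>R (S ^^ j0) (basis_vec (Trunk 1))
      + lam (Primed 1) *\<^sub>R (S ^^ j0) (basis_vec (Primed 1))"
      unfolding funpow_Suc_right o_apply S_0 by (simp add: pow(2) pow_scale b del: One_nat_def)
    then show ?thesis using assms(1,2) by (simp add: nil_trunk nil_primed del: One_nat_def)
  qed
  define e where "e m = Trunk (- int m)" for m
  have e_V: "range e \<subseteq> ?V" by (auto simp: e_def trunk_V)
  obtain x where x: "x \<in> ell2_space (range e)"
    and x_cyclic: "\<And>L m. complex_ell2.subspace L \<Longrightarrow> closed L
      \<Longrightarrow> (\<And>n. n \<ge> j0 \<Longrightarrow> (S ^^ n) x \<in> L) \<Longrightarrow> basis_vec (e m) \<in> L"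
  proof (rule backward_chain_cyclic[OF S _ e_V])
    show "inj e" by (auto simp: e_def inj_def)
    show "lam (e m) > 0" for m using e_V assms(3) by auto
    show "S (basis_vec (e (Suc m))) = lam (e m) *\<^sub>R basis_vec (e m)" for m
      using S_trunk[of "- int (Suc m)"] by (simp add: e_def)
    show "(S ^^ Suc j0) (basis_vec (e 0)) = 0" using nil by (simp add: e_def)
  qed blast
  have xH: "x \<in> ?H" using x e_V by (auto simp: ell2_space_def)
  have pH: "basis_vec (Primed 1) \<in> ?H" using assms(1) by (auto intro: bH simp: primed_V)
  \<comment> \<open>The orbit of \<open>x\<close> alone stays in the closed span of the
    \<open>basis_vec (e m)\<close> and the images of \<open>basis_vec (Trunk 0)\<close>, where the
    two branches occur only in fixed combinations; the extra summand separates them.\<close>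
  define h where "h = x + basis_vec (Primed 1)"
  have hH: "h \<in> ?H" unfolding h_def by (rule complex_ell2.subspace_add[OF H xH pH])
  define L where "L = closure (complex_span {(S ^^ n) h | n. True})"
  have L: "complex_ell2.subspace L" "closed L"
    by (auto simp: L_def intro: complex_subspace_closure)
  have LH: "L \<subseteq> ?H" and SL: "\<And>f. f \<in> L \<Longrightarrow> S f \<in> L"
    using orbit_closure_invariant[OF S H closed_ell2_space hH] by (auto simp: L_def)
  have hL: "(S ^^ n) h \<in> L" for n
    unfolding L_def by (intro subsetD[OF closure_subset] complex_ell2.span_base) auto
  have "(S ^^ n) x \<in> L" if "n \<ge> j0" for n
  proof -
    have "(S ^^ n) (basis_vec (Primed 1)) = 0"
      using that assms(1,2) by (intro nil_primed) auto
    then have "(S ^^ n) h = (S ^^ n) x" by (simp add: h_def pow(2) xH pH del: One_nat_def)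
    then show ?thesis using hL by metis
  qed
  then have eL: "basis_vec (e m) \<in> L" for m using x_cyclic[OF L] by blast
  then have "x \<in> L" using ell2_space_subsetI[OF L, of "range e"] x by auto
  moreover have "h \<in> L" using hL[of 0] by simp
  ultimately have p1: "basis_vec (Primed 1) \<in> L"
    using complex_ell2.subspace_diff[OF L(1), of h x] by (simp add: h_def)
  have unscale: "f \<in> L" if "r *\<^sub>R f \<in> L" "r > 0" for r f
    using complex_ell2.subspace_scale[OF L(1) that(1), of "of_real (1 / r)"] that(2)
    by (simp add: scaleR_ell2_def)
  have primed: "basis_vec (Primed i) \<in> L" if "1 \<le> i" "i \<le> k0" for i
    using that
  proof (induction i rule: dec_induct)
    case (step i)
    then have "lam (Primed (i + 1)) *\<^sub>R basis_vec (Primed (i + 1)) \<in> L"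
      using SL S_primed[of i] by force
    then show ?case using unscale assms(3) primed_V step by auto
  qed (use p1 in simp)
  \<comment> \<open>\<open>S\<close> sends \<open>basis_vec (Trunk 0)\<close> to a mixture of both
    branches; subtracting the primed part, already in \<open>L\<close>, isolates
    \<open>Trunk 1\<close>.\<close>
  have t1: "basis_vec (Trunk 1) \<in> L"
  proof -
    have "lam (Primed 1) *\<^sub>R basis_vec (Primed 1) \<in> L"
      using p1 complex_ell2.subspace_scale[OF L(1)] by (simp add: scaleR_ell2_def)
    moreover have "basis_vec (Trunk 0) \<in> L" using eL[of 0] by (simp add: e_def)
    ultimately have "lam (Trunk 1) *\<^sub>R basis_vec (Trunk 1) \<in> L"
      using complex_ell2.subspace_diff[OF L(1) SL] S_0 by (metis add_diff_cancel_right')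
    then show ?thesis using unscale assms(1-3) trunk_V by auto
  qed
  have pos: "basis_vec (Trunk k) \<in> L" if "1 \<le> k" "k \<le> int j0" for k
    using that
  proof (induction k rule: int_ge_induct)
    case (step k)
    then have "lam (Trunk (k + 1)) *\<^sub>R basis_vec (Trunk (k + 1)) \<in> L"
      using SL S_trunk[of k] by force
    then show ?case using unscale assms(3) trunk_V step by auto
  qed (use t1 in simp)
  have "basis_vec v \<in> L" if "v \<in> ?V" for v
  proof (cases v)
    case (Trunk k)
    show ?thesis
    proof (cases "k \<le> 0")
      case True
      then show ?thesis using eL[of "nat (- k)"] Trunk by (simp add: e_def)
    next
      case False
      then show ?thesis using pos that Trunk trunk_V by simp
    qed
  next
    case (Primed i)
    then show ?thesis using primed that primed_V by simp
  qed
  then have "?H \<subseteq> L" by (rule ell2_space_subsetI[OF L])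
  then show ?thesis
    using LH hH by (auto simp: cyclic_on_def L_def)
qed

end
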